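(* Let $G$ be a finite loop-free multigraph whose degree sequence is graphical. Then $G$ can be transformed into a simple graph by a finite sequence of admissible double edge swaps.
   Context: A loop-free multigraph is a finite undirected graph without loops in which several edges may join the same pair of distinct vertices. The type of an edge joining $u$ and $v$ is the unordered pair $\{u,v\}$, and the multiplicity of $\{u,v\}$ is the number of edges of that type. An edge is simple if it is not a loop and its type has multiplicity one; a graph is simple if all its edges are simple. The degree of a vertex is the number of half-edges attached to it, and the degree sequence is the list of degrees sorted in weakly decreasing order. A weakly decreasing sequence is graphical if it is the degree sequence of some simple graph. Given two distinct edges of types $\{v_1,v_2\}$ and $\{v_3,v_4\}$, the double edge swap $(v_1,v_2)(v_3,v_4)$ removes these two edges and adds an edge of type $\{v_2,v_3\}$ and an edge of type $\{v_4,v_1\}$. The swap is admissible if the two removed edges share no endpoint and not both of them are simple (before the swap). *)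

theory Defs
  imports "HOL-Library.Multiset" "HOL-Library.Uprod"
begin

text \<open>
  A multigraph is given by its vertices and the multiset of the types of its edges: parallel edges
  are not told apart, and multiplicities are counted in the multiset. The library type of
  unordered pairs contains the degenerate pairs \<open>Upair v v\<close>, which are the types of loops;
  \<open>proper_uprod\<close> excludes them.
\<close>

datatype 'a multigraph =
  Multigraph (verts: "'a set") (edges: "'a uprod multiset")

definition fin_multigraph :: "'a multigraph \<Rightarrow> bool" where
  "fin_multigraph G \<longleftrightarrow>
     finite (verts G) \<and> (\<forall>e\<in>#edges G. set_uprod e \<subseteq> verts G)"

definition loop_free :: "'a multigraph \<Rightarrow> bool" where
  "loop_free G \<longleftrightarrow> (\<forall>e\<in>#edges G. proper_uprod e)"

definition simple_edge :: "'a multigraph \<Rightarrow> 'a uprod \<Rightarrow> bool" where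
  "simple_edge G e \<longleftrightarrow> proper_uprod e \<and> count (edges G) e = 1"

definition simple_graph :: "'a multigraph \<Rightarrow> bool" where
  "simple_graph G \<longleftrightarrow> fin_multigraph G \<and> (\<forall>e\<in>#edges G. simple_edge G e)"

text \<open>
  The two half-edges of an edge of the given type, each recorded by the vertex it is attached to:
  \<open>{#u, v#}\<close> for \<open>Upair u v\<close>. A loop contributes two to the degree of its vertex.
\<close>

lift_definition half_edges :: "'a uprod \<Rightarrow> 'a multiset" is "\<lambda>(u, v). {#u, v#}"
  by auto

lemma half_edges_Upair [simp]: "half_edges (Upair u v) = {#u, v#}"
  by transfer simp

definition degree :: "'a multigraph \<Rightarrow> 'a \<Rightarrow> nat" where
  "degree G v = count (\<Sum>e\<in>#edges G. half_edges e) v"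

definition degree_sequence :: "'a multigraph \<Rightarrow> nat list" where
  "degree_sequence G = rev (sorted_list_of_multiset (image_mset (degree G) (mset_set (verts G))))"

text \<open>
  Every finite graph is isomorphic to one whose vertices are natural numbers, so it is no
  restriction to take the realising graph of that type.
\<close>

definition graphical :: "nat list \<Rightarrow> bool" where
  "graphical d \<longleftrightarrow> (\<exists>H :: nat multigraph. simple_graph H \<and> degree_sequence H = d)"

definition swap :: "'a \<Rightarrow> 'a \<Rightarrow> 'a \<Rightarrow> 'a \<Rightarrow> 'a multigraph \<Rightarrow> 'a multigraph" where
  "swap v1 v2 v3 v4 G =
     Multigraph (verts G)
       (edges G - {#Upair v1 v2, Upair v3 v4#} + {#Upair v2 v3, Upair v4 v1#})"

text \<open>
  The multiset inclusion says that the two removed edges are distinct edges of the graph,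
  although in general they could have the same type.
\<close>

definition admissible :: "'a \<Rightarrow> 'a \<Rightarrow> 'a \<Rightarrow> 'a \<Rightarrow> 'a multigraph \<Rightarrow> bool" where
  "admissible v1 v2 v3 v4 G \<longleftrightarrow>
     {#Upair v1 v2, Upair v3 v4#} \<subseteq># edges G \<and>
     {v1, v2} \<inter> {v3, v4} = {} \<and>
     \<not> (simple_edge G (Upair v1 v2) \<and> simple_edge G (Upair v3 v4))"

inductive admissible_swap :: "'a multigraph \<Rightarrow> 'a multigraph \<Rightarrow> bool" where
  "admissible v1 v2 v3 v4 G \<Longrightarrow> admissible_swap G (swap v1 v2 v3 v4 G)"

end

theory Submission
  imports Defs "HOL-Combinatorics.Permutations"
begin

text \<open>
  Let \<open>T\<close> be a simple graph on the vertices of \<open>G\<close> with the same degrees. The sub-multigraphs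
  \<open>G - T\<close> and \<open>T - G\<close> also have equal degrees. If \<open>uv\<close> is a multiple edge of \<open>G\<close>, then it lies in
  \<open>G - T\<close>, and we may assume that in \<open>G - T\<close> the degree of \<open>v\<close> is at most that of \<open>u\<close>. Each
  \<open>T - G\<close>-neighbour \<open>y\<close> of \<open>u\<close> has a neighbour \<open>x\<close> in \<open>G - T\<close>. Not all these \<open>x\<close> can be \<open>v\<close>, as \<open>v\<close>
  would then be joined in \<open>G - T\<close> to all of the \<open>y\<close> and also to \<open>u\<close>. If \<open>x \<noteq> v\<close>, replacing \<open>uv\<close> and
  \<open>yx\<close> by \<open>uy\<close> and \<open>xv\<close> is admissible and makes \<open>G - T\<close> smaller, since only \<open>xv\<close> can be new in it.
\<close>

section \<open>Degrees in a multiset of edges\<close>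

definition edge_degree :: "'a uprod multiset \<Rightarrow> 'a \<Rightarrow> nat" where
  "edge_degree E v = count (\<Sum>e\<in>#E. half_edges e) v"

lemma degree_eq_edge_degree: "degree G v = edge_degree (edges G) v"
  by (simp add: degree_def edge_degree_def)

lemma edge_degree_empty [simp]: "edge_degree {#} v = 0"
  by (simp add: edge_degree_def)

lemma edge_degree_add_mset [simp]:
  "edge_degree (add_mset e E) v = count (half_edges e) v + edge_degree E v"
  by (simp add: edge_degree_def)

lemma edge_degree_union [simp]: "edge_degree (E + F) v = edge_degree E v + edge_degree F v"
  by (simp add: edge_degree_def)

lemma edge_degree_diff:
  "F \<subseteq># E \<Longrightarrow> edge_degree (E - F) v = edge_degree E v - edge_degree F v"
  by (metis add_diff_cancel_right' edge_degree_union subset_mset.diff_add)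

lemma set_mset_half_edges [simp]: "set_mset (half_edges e) = set_uprod e"
  by (cases e) simp

lemma Upair_commute: "Upair a b = Upair b a"
  by simp

lemma half_edges_map_uprod: "half_edges (map_uprod f e) = image_mset f (half_edges e)"
  by (cases e) simp

lemma half_edges_sum_map:
  "(\<Sum>e\<in>#image_mset (map_uprod f) E. half_edges e) = image_mset f (\<Sum>e\<in>#E. half_edges e)"
  by (induction E) (auto simp: half_edges_map_uprod)

lemma half_edges_sum_subset:
  "\<forall>e\<in>#E. set_uprod e \<subseteq> V \<Longrightarrow> set_mset (\<Sum>e\<in>#E. half_edges e) \<subseteq> V"
  by (induction E) auto

lemma edge_degree_eq_0:
  "\<forall>e\<in>#E. set_uprod e \<subseteq> V \<Longrightarrow> v \<notin> V \<Longrightarrow> edge_degree E v = 0"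
  using half_edges_sum_subset[of E V] unfolding edge_degree_def
  by (meson count_eq_zero_iff subsetD)

text \<open>A proper edge has at most one half-edge at \<open>v\<close>, whereas a loop would have
  two.\<close>

lemma edge_degree_eq_size:
  "\<forall>e\<in>#E. proper_uprod e \<Longrightarrow> edge_degree E v = size {#e \<in># E. v \<in> set_uprod e#}"
proof (induction E)
  case (add e E)
  then show ?case by (cases e) auto
qed simp

section \<open>Neighbours and degrees\<close>

lemma image_Upair_neighbours:
  "Upair v ` {y. Upair v y \<in># E} = set_mset {#e \<in># E. v \<in> set_uprod e#}"
proof
  show "set_mset {#e \<in># E. v \<in> set_uprod e#} \<subseteq> Upair v ` {y. Upair v y \<in># E}"
  proof
    fix e assume "e \<in># {#e \<in># E. v \<in> set_uprod e#}"
    then have "e \<in># E" "v \<in> set_uprod e" by auto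
    moreover obtain a b where "e = Upair a b" by (cases e)
    ultimately have "\<exists>y. e = Upair v y" by (auto intro: Upair_inject[THEN iffD2])
    with \<open>e \<in># E\<close> show "e \<in> Upair v ` {y. Upair v y \<in># E}" by auto
  qed
qed auto

lemma card_neighbours:
  "card {y. Upair v y \<in># E} = card (set_mset {#e \<in># E. v \<in> set_uprod e#})"
  unfolding image_Upair_neighbours[symmetric] by (rule card_image[symmetric]) (auto intro: inj_onI)

lemma finite_neighbours: "finite {y. Upair v y \<in># E}"
proof (rule finite_imageD)
  show "finite (Upair v ` {y. Upair v y \<in># E})" unfolding image_Upair_neighbours by simp
qed (auto intro: inj_onI)

text \<open>Neighbours correspond to the distinct edge types at \<open>v\<close>, while the degree
  counts these types with multiplicity. The two numbers agree once no type repeats.\<close>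

lemma card_neighbours_le_edge_degree:
  assumes "\<forall>e\<in>#E. proper_uprod e"
  shows "card {y. Upair v y \<in># E} \<le> edge_degree E v"
proof -
  have "card (set_mset A) \<le> size A" for A :: "'a uprod multiset"
    by (induction A) (auto simp: card_insert_if)
  then show ?thesis by (simp only: card_neighbours edge_degree_eq_size[OF assms])
qed

lemma card_neighbours_eq_edge_degree:
  assumes "\<forall>e\<in>#E. proper_uprod e" and "\<forall>e\<in>#E. count E e = 1"
  shows "card {y. Upair v y \<in># E} = edge_degree E v"
proof -
  let ?F = "{#e \<in># E. v \<in> set_uprod e#}"
  have "size ?F = (\<Sum>e\<in>set_mset ?F. 1)"
    unfolding size_multiset_overloaded_eq using assms(2) by (intro sum.cong) auto
  then show ?thesis by (simp add: card_neighbours edge_degree_eq_size[OF assms(1)])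
qed

section \<open>The exchange step\<close>

lemma pair_subseteq_mset: "a \<in># M \<Longrightarrow> b \<in># M \<Longrightarrow> a \<noteq> b \<Longrightarrow> {#a, b#} \<subseteq># M"
  by (auto simp: insert_subset_eq_iff in_diff_count)

text \<open>One more copy of \<open>a\<close> is still absorbed by \<open>T\<close>, so of the two
  added edges only \<open>b\<close> can be new in the difference.\<close>

lemma exchange_diff_subseteq_mset:
  assumes "count E a < count T a"
  shows "E - R + {#a, b#} - T \<subseteq># E - T - R + {#b#}"
proof (rule mset_subset_eqI)
  fix f
  show "count (E - R + {#a, b#} - T) f \<le> count (E - T - R + {#b#}) f"
    using assms by (cases "f = a"; cases "f = b") simp_all
qed

lemma simplifying_edges_exist:
  fixes E T :: "'a uprod multiset"
  assumes E: "\<forall>e\<in>#E. proper_uprod e"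
    and T: "\<forall>e\<in>#T. proper_uprod e \<and> count T e = 1"
    and deg: "\<And>w. edge_degree E w = edge_degree T w"
    and uv: "Upair u v \<in># E - T"
    and le: "edge_degree (E - T) v \<le> edge_degree (E - T) u"
  obtains x y where "Upair u y \<in># T - E" "Upair y x \<in># E - T" "x \<noteq> v"
proof (rule ccontr)
  note found = that
  assume "\<not> thesis"
  then have no: "x = v" if "Upair u y \<in># T - E" "Upair y x \<in># E - T" for x y
    using that found \<open>\<not> thesis\<close> by blast
  have sub: "\<forall>e\<in>#E - T. proper_uprod e" "\<forall>e\<in>#T - E. proper_uprod e"
    using E T by (meson in_diffD)+
  \<comment> \<open>\<open>T\<close> has multiplicities at most one, so an edge of
    \<open>T - E\<close> is absent from \<open>E\<close>. Hence degrees in \<open>T - E\<close>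
    count neighbours exactly.\<close>
  have once: "\<forall>e\<in>#T - E. count (T - E) e = 1"
  proof
    fix e assume e: "e \<in># T - E"
    then have "count T e = 1" "count E e < count T e"
      using bspec[OF T in_diffD[OF e]] e by (simp_all add: in_diff_count)
    then show "count (T - E) e = 1" by simp
  qed
  \<comment> \<open>Both sums below are the multiset union of \<open>E\<close> and \<open>T\<close>,
    in which each type has the larger of its two multiplicities.\<close>
  have balance: "edge_degree (E - T) w = edge_degree (T - E) w" for w
  proof -
    have "E + (T - E) = T + (E - T)" by (auto intro!: multiset_eqI)
    then have "edge_degree (E + (T - E)) w = edge_degree (T + (E - T)) w" by (rule arg_cong)
    then show ?thesis using deg[of w] by simp
  qed
  let ?Y = "{y. Upair u y \<in># T - E}"
  have Y: "Upair v y \<in># E - T" if "y \<in> ?Y" for y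
  proof -
    \<comment> \<open>The edge to \<open>u\<close> gives \<open>y\<close> positive degree in
      \<open>T - E\<close>, hence by \<open>balance\<close> also in \<open>E - T\<close>.\<close>
    have "u \<in> {z. Upair y z \<in># T - E}"
      using that by (simp add: Upair_commute[of y u])
    then have "0 < card {z. Upair y z \<in># T - E}"
      using finite_neighbours[of y "T - E"] by (subst card_gt_0_iff) blast
    then have "0 < edge_degree (E - T) y"
      using card_neighbours_le_edge_degree[OF sub(2), of y] balance[of y] by linarith
    then have "set_mset {#e \<in># E - T. y \<in> set_uprod e#} \<noteq> {}"
      unfolding edge_degree_eq_size[OF sub(1)] nonempty_has_size[symmetric] set_mset_eq_empty_iff .
    then obtain x where x: "Upair y x \<in># E - T"
      unfolding image_Upair_neighbours[symmetric] by blast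
    with no that have "x = v" by blast
    with x show ?thesis by (simp add: Upair_commute[of v y])
  qed
  \<comment> \<open>The element \<open>u\<close> outside \<open>?Y\<close> makes the count strict:
    \<open>v\<close> has more neighbours in \<open>E - T\<close> than \<open>u\<close> has in
    \<open>T - E\<close>, against \<open>le\<close>.\<close>
  have "u \<notin> ?Y" using sub(2) by auto
  then have "edge_degree (T - E) u < card (insert u ?Y)"
    by (simp add: finite_neighbours card_neighbours_eq_edge_degree[OF sub(2) once])
  also have "\<dots> \<le> card {y. Upair v y \<in># E - T}"
  proof (rule card_mono[OF finite_neighbours])
    have "Upair v u \<in># E - T" using uv by (simp add: Upair_commute[of v u])
    then show "insert u ?Y \<subseteq> {y. Upair v y \<in># E - T}" using Y by blast
  qed
  also have "\<dots> \<le> edge_degree (E - T) v" by (rule card_neighbours_le_edge_degree[OF sub(1)])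
  finally show False using le balance[of u] by linarith
qed

section \<open>Swaps leading to a simple graph\<close>

lemma admissible_preserves:
  assumes "admissible a b c d G" "fin_multigraph G" "loop_free G"
  shows "fin_multigraph (swap a b c d G)" "loop_free (swap a b c d G)"
    "degree (swap a b c d G) = degree G"
proof -
  let ?R = "{#Upair a b, Upair c d#}" and ?A = "{#Upair b c, Upair d a#}"
  have sub: "?R \<subseteq># edges G" and disj: "{a, b} \<inter> {c, d} = {}"
    using assms(1) by (auto simp: admissible_def)
  have "Upair a b \<in># edges G" "Upair c d \<in># edges G"
    using sub by (auto dest: mset_subset_eqD)
  then have abcd: "{a, b, c, d} \<subseteq> verts G"
    using assms(2) by (fastforce simp: fin_multigraph_def)
  show "fin_multigraph (swap a b c d G)"
    using assms(2) abcd by (auto simp: fin_multigraph_def swap_def dest!: in_diffD)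
  \<comment> \<open>Each new edge joins an end of one removed edge to an end of the other, so
    disjointness keeps it from being a loop.\<close>
  show "loop_free (swap a b c d G)"
    using assms(3) disj by (auto simp: loop_free_def swap_def dest!: in_diffD)
  show "degree (swap a b c d G) = degree G"
  proof
    fix v
    \<comment> \<open>The bound guards against truncated subtraction. Removed and added edges have
      the same four half-edges.\<close>
    have "edge_degree ?R v \<le> edge_degree (edges G) v"
      using sub by (metis edge_degree_union le_add1 subset_mset.le_iff_add)
    moreover have "edge_degree ?R v = edge_degree ?A v" by simp
    ultimately show "degree (swap a b c d G) v = degree G v"
      unfolding degree_eq_edge_degree swap_def multigraph.sel edge_degree_union
        edge_degree_diff[OF sub] by linarith
  qed
qed

lemma admissible_swap_closer:
  assumes "fin_multigraph G" "loop_free G" "\<not> simple_graph G"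
    and T: "simple_graph T" "degree T = degree G"
  obtains G' where "admissible_swap G G'" "fin_multigraph G'" "loop_free G'"
    "degree G' = degree G" "size (edges G' - edges T) < size (edges G - edges T)"
proof -
  have E: "\<forall>e\<in>#edges G. proper_uprod e" using assms(2) by (simp add: loop_free_def)
  have T': "\<forall>e\<in>#edges T. proper_uprod e \<and> count (edges T) e = 1"
    using T(1) by (auto simp: simple_graph_def simple_edge_def)
  have deg: "edge_degree (edges G) w = edge_degree (edges T) w" for w
    using T(2) by (simp add: degree_eq_edge_degree[symmetric])
  obtain e where "e \<in># edges G" "\<not> simple_edge G e"
    using assms(1,3) by (auto simp: simple_graph_def)
  then have "count (edges G) e \<noteq> 1" "count (edges G) e > 0"
    using E by (auto simp: simple_edge_def)
  then have e2: "count (edges G) e \<ge> 2" by linarith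
  \<comment> \<open>The ends of \<open>e\<close> are interchangeable, so they can be named to
    satisfy the inequality.\<close>
  obtain u v where e: "e = Upair u v"
    and le: "edge_degree (edges G - edges T) v \<le> edge_degree (edges G - edges T) u"
    by (cases e) (metis Upair_inject nle_le)
  have "count (edges T) e \<le> 1"
    using T' by (metis le_refl not_in_iff zero_le)
  with e2 have uv: "Upair u v \<in># edges G - edges T"
    by (simp add: e in_diff_count)
  obtain x y where uy: "Upair u y \<in># edges T - edges G"
    and yx: "Upair y x \<in># edges G - edges T" and "x \<noteq> v"
    using simplifying_edges_exist[OF E T' deg uv le] by blast
  have disjoint: "f \<noteq> g" if "f \<in># edges G - edges T" "g \<in># edges T - edges G" for f g
    using that by (auto simp: in_diff_count)
  have "u \<noteq> y" using uy T' by (metis in_diffD proper_uprod_simps)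
  \<comment> \<open>If \<open>x = u\<close> or \<open>v = y\<close>, then \<open>Upair u y\<close>
    would be a type of both differences.\<close>
  have "u \<noteq> x" using disjoint[OF yx uy] by auto
  have "v \<noteq> y" using disjoint[OF uv uy] by auto
  have ne: "Upair v u \<noteq> Upair y x" using \<open>u \<noteq> y\<close> \<open>v \<noteq> y\<close> by auto
  have vu: "Upair v u = Upair u v" by (rule Upair_commute)
  have adm: "admissible v u y x G"
    unfolding admissible_def
  proof (intro conjI)
    show "{#Upair v u, Upair y x#} \<subseteq># edges G"
      using pair_subseteq_mset[OF _ _ ne] in_diffD[OF uv] in_diffD[OF yx] by (metis vu)
    show "{v, u} \<inter> {y, x} = {}"
      using \<open>u \<noteq> y\<close> \<open>u \<noteq> x\<close> \<open>v \<noteq> y\<close> \<open>x \<noteq> v\<close> by auto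
    show "\<not> (simple_edge G (Upair v u) \<and> simple_edge G (Upair y x))"
      using e2 by (simp add: simple_edge_def vu e)
  qed
  have "size (edges (swap v u y x G) - edges T) < size (edges G - edges T)"
  proof -
    let ?D = "edges G - edges T"
    have sub: "{#Upair v u, Upair y x#} \<subseteq># ?D"
      using pair_subseteq_mset[OF _ _ ne] uv yx by (metis vu)
    have "edges (swap v u y x G) - edges T
      \<subseteq># ?D - {#Upair v u, Upair y x#} + {#Upair x v#}"
      using uy unfolding swap_def multigraph.sel
      by (intro exchange_diff_subseteq_mset) (simp add: in_diff_count)
    \<comment> \<open>Two edges leave the difference and at most one enters it.\<close>
    from size_mset_mono[OF this] show ?thesis
      using size_Diff_submset[OF sub] size_mset_mono[OF sub] by simp
  qed
  with adm show thesis
    using that admissible_preserves[OF adm assms(1,2)] admissible_swap.intros by metis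
qed

text \<open>The size of the difference to \<open>T\<close> decreases until the graph is simple,
  which may happen before it equals \<open>T\<close>.\<close>

lemma admissible_swaps_reach_simple:
  assumes "fin_multigraph G" "loop_free G" "simple_graph T" "degree T = degree G"
  shows "\<exists>H. admissible_swap\<^sup>*\<^sup>* G H \<and> simple_graph H"
  using assms
proof (induction "size (edges G - edges T)" arbitrary: G rule: less_induct)
  case less
  show ?case
  proof (cases "simple_graph G")
    case False
    then obtain G' where G': "admissible_swap G G'" "fin_multigraph G'" "loop_free G'"
      "degree G' = degree G" "size (edges G' - edges T) < size (edges G - edges T)"
      using admissible_swap_closer less.prems by metis
    from less.hyps[OF G'(5,2,3) less.prems(3)] G'(4) less.prems(4)
    obtain H where "admissible_swap\<^sup>*\<^sup>* G' H" "simple_graph H" by auto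
    with G'(1) show ?thesis by (meson converse_rtranclp_into_rtranclp)
  qed blast
qed

section \<open>Moving a simple realisation onto the vertices of G\<close>

lemma ex_bij_betw_of_image_mset_eq:
  assumes "finite A" "finite B" "image_mset f (mset_set A) = image_mset g (mset_set B)"
  obtains h where "bij_betw h A B" "\<forall>x\<in>A. g (h x) = f x"
proof -
  have "card A = card B" using assms(3) by (metis size_image_mset size_mset_set)
  \<comment> \<open>The bijection \<open>k\<close> is arbitrary; a permutation \<open>p\<close> of
    \<open>A\<close> applied before it aligns the values of \<open>f\<close> and
    \<open>g\<close>.\<close>
  then obtain k where k: "bij_betw k A B" using assms(1,2) finite_same_card_bij by blast
  then have "image_mset f (mset_set A) = image_mset (g \<circ> k) (mset_set A)"
    by (simp add: assms(3) image_mset.compositionality[symmetric]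
        image_mset_mset_set bij_betw_def)
  then obtain p where p: "p permutes A" "\<forall>x\<in>A. f x = (g \<circ> k) (p x)"
    using image_mset_eq_implies_permutes[OF assms(1)] by metis
  have "bij_betw (k \<circ> p) A B" using bij_betw_trans[OF permutes_imp_bij[OF p(1)] k] .
  with p(2) show thesis by (intro that[of "k \<circ> p"]) auto
qed

lemma count_image_mset_inj_on:
  assumes "inj_on f V" "set_mset M \<subseteq> V" "x \<in> V"
  shows "count (image_mset f M) (f x) = count M x"
  using assms(2)
proof (induction M)
  case (add y M)
  then show ?case using assms(1,3) by (auto dest: inj_onD)
qed simp

lemma simple_realisation_on_verts:
  fixes G :: "'a multigraph" and H :: "'b multigraph"
  assumes G: "fin_multigraph G" and H: "simple_graph H"
    and seq: "degree_sequence H = degree_sequence G"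
  obtains T :: "'a multigraph" where "simple_graph T" "degree T = degree G"
proof -
  have fin: "finite (verts G)" "finite (verts H)"
    and EH: "\<forall>e\<in>#edges H. set_uprod e \<subseteq> verts H"
    and simple: "\<forall>e\<in>#edges H. proper_uprod e \<and> count (edges H) e = 1"
    using assms by (auto simp: simple_graph_def simple_edge_def fin_multigraph_def)
  have "image_mset (degree H) (mset_set (verts H)) = image_mset (degree G) (mset_set (verts G))"
    using seq unfolding degree_sequence_def by (metis mset_sorted_list_of_multiset rev_rev_ident)
  then obtain h where h: "bij_betw h (verts H) (verts G)" "\<forall>x\<in>verts H. degree G (h x) = degree H x"
    by (rule ex_bij_betw_of_image_mset_eq[OF fin(2,1)])
  have inj: "inj_on h (verts H)" and img: "h ` verts H = verts G"
    using h(1) by (auto simp: bij_betw_def)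
  define T where "T = Multigraph (verts G) (image_mset (map_uprod h) (edges H))"
  have sub: "\<forall>e\<in>#edges T. set_uprod e \<subseteq> verts G"
    using EH img by (auto simp: T_def uprod.set_map)
  \<comment> \<open>\<open>h\<close> is injective only on \<open>verts H\<close>, so the induced map
    is restricted to pairs inside that set. Its injectivity keeps distinct edges of \<open>H\<close>
    from becoming parallel.\<close>
  have injU: "inj_on (map_uprod h) {e. set_uprod e \<subseteq> verts H}"
    using inj by (intro inj_onI, elim CollectE) (rule uprod.inj_map_strong, auto dest: inj_onD)
  have "proper_uprod (map_uprod h e)" if "e \<in># edges H" for e
    using that EH simple inj by (cases e) (fastforce dest: inj_onD)
  moreover have "count (edges T) (map_uprod h e) = 1" if "e \<in># edges H" for e
    using that EH simple count_image_mset_inj_on[OF injU, of "edges H" e] by (auto simp: T_def)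
  ultimately have "simple_graph T"
    using fin(1) sub by (auto simp: simple_graph_def fin_multigraph_def simple_edge_def T_def)
  moreover have "degree T = degree G"
  proof
    fix v
    show "degree T v = degree G v"
    proof (cases "v \<in> verts G")
      case True
      then obtain x where x: "x \<in> verts H" "v = h x" using img by auto
      have "(\<Sum>e\<in>#edges T. half_edges e) = image_mset h (\<Sum>e\<in>#edges H. half_edges e)"
        by (simp only: T_def multigraph.sel half_edges_sum_map)
      then have "degree T v = degree H x"
        using count_image_mset_inj_on[OF inj half_edges_sum_subset[OF EH] x(1)]
        by (simp add: degree_def x(2))
      then show ?thesis using h(2) x by simp
    next
      \<comment> \<open>\<open>degree\<close> is a total function, and off the vertex set both
        degrees are 0.\<close>
      case False
      then show ?thesis
        using sub G edge_degree_eq_0[of "edges T" "verts G" v]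
          edge_degree_eq_0[of "edges G" "verts G" v]
        by (simp add: degree_eq_edge_degree fin_multigraph_def)
    qed
  qed
  ultimately show thesis by (rule that)
qed

theorem theorem3p1:
  fixes G :: "'a multigraph"
  assumes "fin_multigraph G"
    and "loop_free G"
    and "graphical (degree_sequence G)"
  shows "\<exists>H. admissible_swap\<^sup>*\<^sup>* G H \<and> simple_graph H"
proof -
  obtain N :: "nat multigraph" where "simple_graph N" "degree_sequence N = degree_sequence G"
    using assms(3) by (auto simp: graphical_def)
  then obtain T :: "'a multigraph" where "simple_graph T" "degree T = degree G"
    using simple_realisation_on_verts[OF assms(1)] by metis
  then show ?thesis by (rule admissible_swaps_reach_simple[OF assms(1,2)])
qed

end
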